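(* Let $X$ be a totally ordered ep-metric space. Then there is an isomorphism of ep-metric spaces $$\Re(V_\ast(X))\cong X$$ between the realization of the Vietoris-Rips diagram $V_\ast(X)$ and the ep-metric space $X$.
   Context: An ep-metric space (extended pseudo-metric space) is a set $Y$ with a function $d:Y\times Y\to[0,\infty]$ such that $d(x,x)=0$, $d(x,y)=d(y,x)$ and $d(x,z)\le d(x,y)+d(y,z)$. A morphism $f:(X,d_X)\to(Y,d_Y)$ is a function with $d_Y(f(x),f(y))\le d_X(x,y)$ for all $x,y$. The resulting category $ep\text{-}\mathbf{Met}$ is cocomplete. A totally ordered ep-metric space is an ep-metric space whose underlying set is equipped with a total order (no compatibility with the metric is required). The interval $[0,\infty]$ is regarded as a poset category. For a totally ordered ep-metric space $X$, the Vietoris-Rips diagram $V_\ast(X):[0,\infty]\to s\mathbf{Set}$ is the functor such that the $n$-simplices of $V_s(X)$ are the strings $x_0\le x_1\le\dots\le x_n$ of elements of $X$ with $d(x_i,x_j)\le s$ for all $i,j$ (a simplicial subset of the nerve of the totally ordered set $X$), with the inclusions $V_s(X)\subset V_t(X)$ for $s\le t$ as transition maps. For a functor $Y:[0,\infty]\to s\mathbf{Set}$ write $Y_s$ for its value at $s$. For a simplicial set $K$ and $s\in[0,\infty]$, $L_sK:[0,\infty]\to s\mathbf{Set}$ is the diagram with $(L_sK)_t=\emptyset$ for $t<s$ and $(L_sK)_t=K$ for $t\ge s$ (with identity transition maps); maps $L_sK\to Y$ correspond to simplicial set maps $K\to Y_s$. The category of simplices $\mathbf{\Delta}/Y$ has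 objects the maps $L_s\Delta^n\to Y$ ($s\in[0,\infty]$, $n\ge0$) and morphisms the maps $L_t\Delta^m\to L_s\Delta^n$ over $Y$; such a map consists of a relation $s\le t$ and a simplicial map $\theta:\Delta^m\to\Delta^n$. $U^n_s$ is the ep-metric space with underlying set $\mathbf n=\{0,1,\dots,n\}$ and $d(i,j)=s$ for $i\neq j$. A morphism $L_t\Delta^m\to L_s\Delta^n$, consisting of a relation $s\le t$ and a simplicial map $\theta:\Delta^m\to\Delta^n$, induces the morphism $\theta:U^m_t\to U^n_s$ given by the vertex function $\theta:\mathbf m\to\mathbf n$. The realization of $Y$ is the colimit in $ep\text{-}\mathbf{Met}$ $$\Re(Y)=\varinjlim_{L_s\Delta^n\to Y}U^n_s$$ indexed by $\mathbf{\Delta}/Y$. *)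

theory Defs
  imports "HOL-Library.FuncSet" "HOL-Library.Extended_Nonnegative_Real"
begin

section \<open>Extended pseudo-metric spaces\<close>

record 'a ep_space =
  ep_pts :: "'a set"
  ep_dist :: "'a \<Rightarrow> 'a \<Rightarrow> ennreal"

definition ep_metric :: "'a ep_space \<Rightarrow> bool" where
  "ep_metric X \<longleftrightarrow>
     (\<forall>x\<in>ep_pts X. ep_dist X x x = 0) \<and>
     (\<forall>x\<in>ep_pts X. \<forall>y\<in>ep_pts X. ep_dist X x y = ep_dist X y x) \<and>
     (\<forall>x\<in>ep_pts X. \<forall>y\<in>ep_pts X. \<forall>z\<in>ep_pts X.
        ep_dist X x z \<le> ep_dist X x y + ep_dist X y z)"

definition ep_maps :: "'a ep_space \<Rightarrow> 'b ep_space \<Rightarrow> ('a \<Rightarrow> 'b) set" where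
  "ep_maps X Y = {f \<in> ep_pts X \<rightarrow>\<^sub>E ep_pts Y.
     \<forall>x\<in>ep_pts X. \<forall>y\<in>ep_pts X. ep_dist Y (f x) (f y) \<le> ep_dist X x y}"

definition ep_isomorphic :: "'a ep_space \<Rightarrow> 'b ep_space \<Rightarrow> bool" where
  "ep_isomorphic X Y \<longleftrightarrow> (\<exists>f\<in>ep_maps X Y. \<exists>g\<in>ep_maps Y X.
     (\<forall>x\<in>ep_pts X. g (f x) = x) \<and> (\<forall>y\<in>ep_pts Y. f (g y) = y))"

section \<open>Colimits of ep-metric spaces\<close>

text \<open>
  A diagram consists of a set \<open>I\<close> of objects, sets \<open>H a b\<close> of morphisms,
  spaces \<open>F a\<close> and maps \<open>Fm a b \<phi>\<close>. The points of its colimit are those of the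
  colimit of underlying sets, and the distance is the largest ep-metric for which
  all coprojections are morphisms. Theorem \<open>ep_colimit_universal\<close> below is the
  universal property.
\<close>

definition colim_gen ::
  "'i set \<Rightarrow> ('i \<Rightarrow> 'i \<Rightarrow> 'm set) \<Rightarrow> ('i \<Rightarrow> 'p ep_space) \<Rightarrow>
   ('i \<Rightarrow> 'i \<Rightarrow> 'm \<Rightarrow> 'p \<Rightarrow> 'p) \<Rightarrow> ('i \<times> 'p) rel" where
  "colim_gen I H F Fm = {((a, x), (b, y)).
     a \<in> I \<and> x \<in> ep_pts (F a) \<and> b \<in> I \<and> y \<in> ep_pts (F b) \<and>
     (\<exists>\<phi>\<in>H a b. y = Fm a b \<phi> x)}"

definition colim_rel ::
  "'i set \<Rightarrow> ('i \<Rightarrow> 'i \<Rightarrow> 'm set) \<Rightarrow> ('i \<Rightarrow> 'p ep_space) \<Rightarrow>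
   ('i \<Rightarrow> 'i \<Rightarrow> 'm \<Rightarrow> 'p \<Rightarrow> 'p) \<Rightarrow> ('i \<times> 'p) rel" where
  "colim_rel I H F Fm =
     (let C = Sigma I (\<lambda>a. ep_pts (F a)); G = colim_gen I H F Fm
      in (G \<union> G\<inverse>)\<^sup>* \<inter> C \<times> C)"

definition colim_pts ::
  "'i set \<Rightarrow> ('i \<Rightarrow> 'i \<Rightarrow> 'm set) \<Rightarrow> ('i \<Rightarrow> 'p ep_space) \<Rightarrow>
   ('i \<Rightarrow> 'i \<Rightarrow> 'm \<Rightarrow> 'p \<Rightarrow> 'p) \<Rightarrow> ('i \<times> 'p) set set" where
  "colim_pts I H F Fm = Sigma I (\<lambda>a. ep_pts (F a)) // colim_rel I H F Fm"

definition coproj ::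
  "'i set \<Rightarrow> ('i \<Rightarrow> 'i \<Rightarrow> 'm set) \<Rightarrow> ('i \<Rightarrow> 'p ep_space) \<Rightarrow>
   ('i \<Rightarrow> 'i \<Rightarrow> 'm \<Rightarrow> 'p \<Rightarrow> 'p) \<Rightarrow> 'i \<Rightarrow> 'p \<Rightarrow> ('i \<times> 'p) set" where
  "coproj I H F Fm a = (\<lambda>x\<in>ep_pts (F a). colim_rel I H F Fm `` {(a, x)})"

definition colim_metrics ::
  "'i set \<Rightarrow> ('i \<Rightarrow> 'i \<Rightarrow> 'm set) \<Rightarrow> ('i \<Rightarrow> 'p ep_space) \<Rightarrow>
   ('i \<Rightarrow> 'i \<Rightarrow> 'm \<Rightarrow> 'p \<Rightarrow> 'p) \<Rightarrow>
   (('i \<times> 'p) set \<Rightarrow> ('i \<times> 'p) set \<Rightarrow> ennreal) set" where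
  "colim_metrics I H F Fm = {e.
     let Q = \<lparr>ep_pts = colim_pts I H F Fm, ep_dist = e\<rparr>
     in ep_metric Q \<and> (\<forall>a\<in>I. coproj I H F Fm a \<in> ep_maps (F a) Q)}"

definition ep_colimit ::
  "'i set \<Rightarrow> ('i \<Rightarrow> 'i \<Rightarrow> 'm set) \<Rightarrow> ('i \<Rightarrow> 'p ep_space) \<Rightarrow>
   ('i \<Rightarrow> 'i \<Rightarrow> 'm \<Rightarrow> 'p \<Rightarrow> 'p) \<Rightarrow> ('i \<times> 'p) set ep_space" where
  "ep_colimit I H F Fm =
     \<lparr>ep_pts = colim_pts I H F Fm,
      ep_dist = (\<lambda>p q. SUP e\<in>colim_metrics I H F Fm. e p q)\<rparr>"

lemma equiv_colim_rel: "equiv (Sigma I (\<lambda>a. ep_pts (F a))) (colim_rel I H F Fm)"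
proof -
  let ?G = "colim_gen I H F Fm"
  have "sym ((?G \<union> ?G\<inverse>)\<^sup>*)"
    by (intro sym_rtrancl) (auto simp: sym_def)
  moreover have "trans ((?G \<union> ?G\<inverse>)\<^sup>*)" by (rule trans_rtrancl)
  ultimately show ?thesis
    unfolding colim_rel_def Let_def equiv_def refl_on_def sym_def trans_def by blast
qed

lemma coproj_in_pts:
  assumes "a \<in> I" "x \<in> ep_pts (F a)"
  shows "coproj I H F Fm a x \<in> colim_pts I H F Fm"
  using assms by (auto simp: coproj_def colim_pts_def intro!: quotientI)

lemma coproj_PiE:
  "a \<in> I \<Longrightarrow> coproj I H F Fm a \<in> ep_pts (F a) \<rightarrow>\<^sub>E colim_pts I H F Fm"
  by (intro PiE_I coproj_in_pts) (auto simp: coproj_def)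

lemma colim_pts_cases:
  assumes "p \<in> colim_pts I H F Fm"
  obtains a x where "a \<in> I" "x \<in> ep_pts (F a)" "p = coproj I H F Fm a x"
  using assms unfolding colim_pts_def by (elim quotientE) (auto simp: coproj_def)

lemma ep_metric_colimit: "ep_metric (ep_colimit I H F Fm)"
  unfolding ep_metric_def
proof (intro conjI ballI)
  let ?M = "colim_metrics I H F Fm"
  have M: "ep_metric \<lparr>ep_pts = colim_pts I H F Fm, ep_dist = e\<rparr>" if "e \<in> ?M" for e
    using that by (simp add: colim_metrics_def Let_def)
  fix x assume "x \<in> ep_pts (ep_colimit I H F Fm)"
  then have x: "x \<in> colim_pts I H F Fm" by (simp add: ep_colimit_def)
  have "e x x \<le> 0" if "e \<in> ?M" for e
    using M[OF that] x by (simp add: ep_metric_def)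
  then have "(SUP e\<in>?M. e x x) \<le> 0" by (rule SUP_least)
  then show "ep_dist (ep_colimit I H F Fm) x x = 0" by (simp add: ep_colimit_def)
  fix y assume "y \<in> ep_pts (ep_colimit I H F Fm)"
  then have y: "y \<in> colim_pts I H F Fm" by (simp add: ep_colimit_def)
  have "e x y = e y x" if "e \<in> ?M" for e
    using M[OF that] x y by (simp add: ep_metric_def)
  then have "(SUP e\<in>?M. e x y) = (SUP e\<in>?M. e y x)" by (intro SUP_cong refl)
  then show "ep_dist (ep_colimit I H F Fm) x y = ep_dist (ep_colimit I H F Fm) y x"
    by (simp add: ep_colimit_def)
  fix z assume "z \<in> ep_pts (ep_colimit I H F Fm)"
  then have z: "z \<in> colim_pts I H F Fm" by (simp add: ep_colimit_def)
  have "e x z \<le> (SUP e\<in>?M. e x y) + (SUP e\<in>?M. e y z)" if e: "e \<in> ?M" for e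
  proof -
    have "e x z \<le> e x y + e y z" using M[OF e] x y z by (simp add: ep_metric_def)
    also have "\<dots> \<le> (SUP e\<in>?M. e x y) + (SUP e\<in>?M. e y z)"
      by (intro add_mono SUP_upper e)
    finally show ?thesis .
  qed
  then show "ep_dist (ep_colimit I H F Fm) x z
      \<le> ep_dist (ep_colimit I H F Fm) x y + ep_dist (ep_colimit I H F Fm) y z"
    by (simp add: ep_colimit_def SUP_least)
qed

lemma coproj_in_maps:
  assumes a: "a \<in> I"
  shows "coproj I H F Fm a \<in> ep_maps (F a) (ep_colimit I H F Fm)"
proof -
  let ?c = "coproj I H F Fm a"
  have "e (?c x) (?c y) \<le> ep_dist (F a) x y"
    if "e \<in> colim_metrics I H F Fm" "x \<in> ep_pts (F a)" "y \<in> ep_pts (F a)" for e x y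
    using that a by (auto simp: colim_metrics_def Let_def ep_maps_def)
  moreover have "?c \<in> ep_pts (F a) \<rightarrow>\<^sub>E colim_pts I H F Fm"
    by (rule coproj_PiE[OF a])
  ultimately show ?thesis
    by (auto simp: ep_maps_def ep_colimit_def intro!: SUP_least)
qed

lemma coproj_cocone:
  assumes "a \<in> I" "b \<in> I" "\<phi> \<in> H a b" "Fm a b \<phi> \<in> ep_maps (F a) (F b)"
    and "x \<in> ep_pts (F a)"
  shows "coproj I H F Fm b (Fm a b \<phi> x) = coproj I H F Fm a x"
proof -
  have y: "Fm a b \<phi> x \<in> ep_pts (F b)" using assms by (auto simp: ep_maps_def)
  then have "((a, x), (b, Fm a b \<phi> x)) \<in> colim_rel I H F Fm"
    using assms by (auto simp: colim_rel_def Let_def colim_gen_def)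
  from equiv_class_eq[OF equiv_colim_rel this] show ?thesis
    using y assms by (simp add: coproj_def)
qed

theorem ep_colimit_universal:
  assumes Z: "ep_metric Z"
    and h: "\<And>a. a \<in> I \<Longrightarrow> h a \<in> ep_maps (F a) Z"
    and cocone: "\<And>a b \<phi> x. a \<in> I \<Longrightarrow> b \<in> I \<Longrightarrow> \<phi> \<in> H a b \<Longrightarrow>
      x \<in> ep_pts (F a) \<Longrightarrow> h b (Fm a b \<phi> x) = h a x"
  shows "\<exists>!u. u \<in> ep_maps (ep_colimit I H F Fm) Z \<and>
    (\<forall>a\<in>I. \<forall>x\<in>ep_pts (F a). u (coproj I H F Fm a x) = h a x)"
proof -
  let ?c = "coproj I H F Fm" and ?P = "colim_pts I H F Fm"
  have resp: "h (fst p) (snd p) = h (fst q) (snd q)"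
    if "(p, q) \<in> (colim_gen I H F Fm \<union> (colim_gen I H F Fm)\<inverse>)\<^sup>*" for p q
    using that by induction (auto simp: colim_gen_def cocone)
  have ceq: "h a x = h b y"
    if "?c a x = ?c b y" "a \<in> I" "x \<in> ep_pts (F a)" "b \<in> I" "y \<in> ep_pts (F b)"
    for a x b y
  proof -
    have "((a, x), (b, y)) \<in> colim_rel I H F Fm"
      using that eq_equiv_class[OF _ equiv_colim_rel[of I F H Fm], of "(a, x)" "(b, y)"]
      by (simp add: coproj_def)
    then show ?thesis using resp[of "(a, x)" "(b, y)"] by (simp add: colim_rel_def Let_def)
  qed
  define u where "u = (\<lambda>p\<in>?P. THE z. \<exists>a\<in>I. \<exists>x\<in>ep_pts (F a). p = ?c a x \<and> z = h a x)"
  have u: "u (?c a x) = h a x" if "a \<in> I" "x \<in> ep_pts (F a)" for a x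
  proof -
    have "(THE z. \<exists>b\<in>I. \<exists>y\<in>ep_pts (F b). ?c a x = ?c b y \<and> z = h b y) = h a x"
      using that ceq by (intro the_equality) blast+
    then show ?thesis using coproj_in_pts[of a I x F H Fm] that by (simp add: u_def)
  qed
  have hZ: "h a x \<in> ep_pts Z" if "a \<in> I" "x \<in> ep_pts (F a)" for a x
    using h[OF that(1)] that(2) by (auto simp: ep_maps_def)
  have uP: "u p \<in> ep_pts Z" if "p \<in> ?P" for p
    using that by (elim colim_pts_cases) (simp add: u hZ)
  let ?e = "\<lambda>p q. ep_dist Z (u p) (u q)"
  have "?e \<in> colim_metrics I H F Fm"
  proof -
    have "ep_metric \<lparr>ep_pts = ?P, ep_dist = ?e\<rparr>"
      using Z uP by (auto simp: ep_metric_def)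
    moreover have "?c a \<in> ep_maps (F a) \<lparr>ep_pts = ?P, ep_dist = ?e\<rparr>" if a: "a \<in> I" for a
    proof -
      have "?c a \<in> ep_pts (F a) \<rightarrow>\<^sub>E ?P"
        by (rule coproj_PiE[OF a])
      then show ?thesis using h[OF a] a by (auto simp: ep_maps_def u)
    qed
    ultimately show ?thesis by (simp add: colim_metrics_def Let_def)
  qed
  then have "?e p q \<le> ep_dist (ep_colimit I H F Fm) p q" for p q
    unfolding ep_colimit_def by (auto intro!: SUP_upper2[where i = ?e])
  moreover have "u \<in> ?P \<rightarrow>\<^sub>E ep_pts Z" using uP by (auto simp: u_def)
  ultimately have "u \<in> ep_maps (ep_colimit I H F Fm) Z"
    by (auto simp: ep_maps_def ep_colimit_def)
  moreover have "v = u"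
    if v: "v \<in> ep_maps (ep_colimit I H F Fm) Z"
      "\<forall>a\<in>I. \<forall>x\<in>ep_pts (F a). v (?c a x) = h a x" for v
  proof
    fix p
    show "v p = u p"
    proof (cases "p \<in> ?P")
      case True
      then show ?thesis by (elim colim_pts_cases) (simp add: u v(2))
    next
      case False
      then show ?thesis
        using v(1) by (auto simp: ep_maps_def ep_colimit_def u_def dest: PiE_arb)
    qed
  qed
  ultimately show ?thesis using u by blast
qed

section \<open>Simplicial sets\<close>

text \<open>
  \<open>simp_op K m n \<theta>\<close> is the structure map from \<open>n\<close>-simplices to \<open>m\<close>-simplices
  induced by a monotone \<open>\<theta>\<close> from \<open>{0..m}\<close> to \<open>{0..n}\<close>.
\<close>

record 'a sset =
  simplices :: "nat \<Rightarrow> 'a set"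
  simp_op :: "nat \<Rightarrow> nat \<Rightarrow> (nat \<Rightarrow> nat) \<Rightarrow> 'a \<Rightarrow> 'a"

definition ord_maps :: "nat \<Rightarrow> nat \<Rightarrow> (nat \<Rightarrow> nat) set" where
  "ord_maps m n = {\<theta> \<in> {..m} \<rightarrow>\<^sub>E {..n}. mono_on {..m} \<theta>}"

definition is_sset :: "'a sset \<Rightarrow> bool" where
  "is_sset K \<longleftrightarrow>
     (\<forall>m n. \<forall>\<theta>\<in>ord_maps m n. simp_op K m n \<theta> \<in> simplices K n \<rightarrow> simplices K m) \<and>
     (\<forall>n. \<forall>x\<in>simplices K n. simp_op K n n (\<lambda>i\<in>{..n}. i) x = x) \<and>
     (\<forall>k m n. \<forall>\<eta>\<in>ord_maps k m. \<forall>\<theta>\<in>ord_maps m n. \<forall>x\<in>simplices K n.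
        simp_op K k n (compose {..k} \<theta> \<eta>) x = simp_op K k m \<eta> (simp_op K m n \<theta> x))"

definition sset_maps :: "'a sset \<Rightarrow> 'b sset \<Rightarrow> (nat \<Rightarrow> 'a \<Rightarrow> 'b) set" where
  "sset_maps K L = {f.
     (\<forall>n. f n \<in> simplices K n \<rightarrow>\<^sub>E simplices L n) \<and>
     (\<forall>m n. \<forall>\<theta>\<in>ord_maps m n. \<forall>x\<in>simplices K n.
        f m (simp_op K m n \<theta> x) = simp_op L m n \<theta> (f n x))}"

definition nerve :: "'a set \<Rightarrow> 'a rel \<Rightarrow> (nat \<Rightarrow> 'a) sset" where
  "nerve A r =
     \<lparr>simplices = (\<lambda>n. {\<sigma> \<in> {..n} \<rightarrow>\<^sub>E A. \<forall>i j. i \<le> j \<and> j \<le> n \<longrightarrow> (\<sigma> i, \<sigma> j) \<in> r}),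
      simp_op = (\<lambda>m n \<theta> \<sigma>. compose {..m} \<sigma> \<theta>)\<rparr>"

definition std_simplex :: "nat \<Rightarrow> (nat \<Rightarrow> nat) sset" where
  "std_simplex n =
     \<lparr>simplices = (\<lambda>k. ord_maps k n), simp_op = (\<lambda>m k \<theta> \<sigma>. compose {..m} \<sigma> \<theta>)\<rparr>"

section \<open>Diagrams of simplicial sets indexed by the poset of extended nonnegative reals\<close>

record 'a sset_diag =
  at_stage :: "ennreal \<Rightarrow> 'a sset"
  transition :: "ennreal \<Rightarrow> ennreal \<Rightarrow> nat \<Rightarrow> 'a \<Rightarrow> 'a"

definition is_sset_diag :: "'a sset_diag \<Rightarrow> bool" where
  "is_sset_diag Y \<longleftrightarrow>
     (\<forall>s. is_sset (at_stage Y s)) \<and>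
     (\<forall>s t. s \<le> t \<longrightarrow> transition Y s t \<in> sset_maps (at_stage Y s) (at_stage Y t)) \<and>
     (\<forall>s n. \<forall>x\<in>simplices (at_stage Y s) n. transition Y s s n x = x) \<and>
     (\<forall>s t u n. s \<le> t \<and> t \<le> u \<longrightarrow> (\<forall>x\<in>simplices (at_stage Y s) n.
        transition Y s u n x = transition Y t u n (transition Y s t n x)))"

definition diag_maps ::
  "'a sset_diag \<Rightarrow> 'b sset_diag \<Rightarrow> (ennreal \<Rightarrow> nat \<Rightarrow> 'a \<Rightarrow> 'b) set" where
  "diag_maps Y Z = {f.
     (\<forall>s. f s \<in> sset_maps (at_stage Y s) (at_stage Z s)) \<and>
     (\<forall>s t n. s \<le> t \<longrightarrow> (\<forall>x\<in>simplices (at_stage Y s) n.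
        f t n (transition Y s t n x) = transition Z s t n (f s n x)))}"

definition diag_comp ::
  "'a sset_diag \<Rightarrow> (ennreal \<Rightarrow> nat \<Rightarrow> 'b \<Rightarrow> 'c) \<Rightarrow> (ennreal \<Rightarrow> nat \<Rightarrow> 'a \<Rightarrow> 'b) \<Rightarrow>
   ennreal \<Rightarrow> nat \<Rightarrow> 'a \<Rightarrow> 'c" where
  "diag_comp Y g f = (\<lambda>s n. compose (simplices (at_stage Y s) n) (g s n) (f s n))"

definition L_diag :: "ennreal \<Rightarrow> 'a sset \<Rightarrow> 'a sset_diag" where
  "L_diag s K =
     \<lparr>at_stage = (\<lambda>t. if s \<le> t then K else K\<lparr>simplices := \<lambda>n. {}\<rparr>),
      transition = (\<lambda>t u n. \<lambda>x\<in>(if s \<le> t then simplices K n else {}). x)\<rparr>"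

definition vietoris_rips :: "'a ep_space \<Rightarrow> 'a rel \<Rightarrow> (nat \<Rightarrow> 'a) sset_diag" where
  "vietoris_rips X r =
     (let V = \<lambda>s n. {\<sigma> \<in> simplices (nerve (ep_pts X) r) n.
                       \<forall>i\<le>n. \<forall>j\<le>n. ep_dist X (\<sigma> i) (\<sigma> j) \<le> s}
      in \<lparr>at_stage = (\<lambda>s. (nerve (ep_pts X) r)\<lparr>simplices := V s\<rparr>),
          transition = (\<lambda>s t n. \<lambda>\<sigma>\<in>V s n. \<sigma>)\<rparr>)"

section \<open>The category of simplices and the realization\<close>

text \<open>The object \<open>(s, n, f)\<close> is the map \<open>f\<close> from \<open>L_diag s (std_simplex n)\<close> to \<open>Y\<close>.\<close>

type_synonym 'a simplex_obj =
  "ennreal \<times> nat \<times> (ennreal \<Rightarrow> nat \<Rightarrow> (nat \<Rightarrow> nat) \<Rightarrow> 'a)"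

type_synonym simplex_mor = "ennreal \<Rightarrow> nat \<Rightarrow> (nat \<Rightarrow> nat) \<Rightarrow> (nat \<Rightarrow> nat)"

definition simplex_objs :: "'a sset_diag \<Rightarrow> 'a simplex_obj set" where
  "simplex_objs Y = {(s, n, f). f \<in> diag_maps (L_diag s (std_simplex n)) Y}"

definition simplex_homs :: "'a simplex_obj \<Rightarrow> 'a simplex_obj \<Rightarrow> simplex_mor set" where
  "simplex_homs = (\<lambda>(t, m, g) (s, n, f).
     {\<phi> \<in> diag_maps (L_diag t (std_simplex m)) (L_diag s (std_simplex n)).
        diag_comp (L_diag t (std_simplex m)) f \<phi> = g})"

definition U_space :: "nat \<Rightarrow> ennreal \<Rightarrow> nat ep_space" where
  "U_space n s = \<lparr>ep_pts = {..n}, ep_dist = (\<lambda>i j. if i = j then 0 else s)\<rparr>"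

definition U_obj :: "'a simplex_obj \<Rightarrow> nat ep_space" where
  "U_obj = (\<lambda>(s, n, f). U_space n s)"

text \<open>
  The vertex \<open>i\<close> of the standard \<open>m\<close>-simplex is the \<open>0\<close>-simplex \<open>\<lambda>j\<in>{..0}. i\<close>.
  A morphism out of \<open>L_diag t (std_simplex m)\<close> is determined by its component at
  stage \<open>t\<close>, whose effect on vertices is the vertex function.
\<close>

definition U_mor ::
  "'a simplex_obj \<Rightarrow> 'a simplex_obj \<Rightarrow> simplex_mor \<Rightarrow> nat \<Rightarrow> nat" where
  "U_mor = (\<lambda>(t, m, g) (s, n, f) \<phi>. \<lambda>i\<in>{..m}. \<phi> t 0 (\<lambda>j\<in>{..0}. i) 0)"

definition realization :: "'a sset_diag \<Rightarrow> ('a simplex_obj \<times> nat) set ep_space" where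
  "realization Y = ep_colimit (simplex_objs Y) simplex_homs U_obj U_mor"

section \<open>Basic properties\<close>

lemma ord_maps_comp:
  "\<eta> \<in> ord_maps k m \<Longrightarrow> \<theta> \<in> ord_maps m n \<Longrightarrow> compose {..k} \<theta> \<eta> \<in> ord_maps k n"
  unfolding ord_maps_def by (auto simp: compose_def mono_on_def PiE_iff)

lemma is_sset_std_simplex: "is_sset (std_simplex n)"
  unfolding is_sset_def
proof (intro conjI allI ballI)
  fix m k \<theta> assume "\<theta> \<in> ord_maps m k"
  then show "simp_op (std_simplex n) m k \<theta> \<in>
      simplices (std_simplex n) k \<rightarrow> simplices (std_simplex n) m"
    by (auto simp: std_simplex_def intro: ord_maps_comp)
next
  fix k x assume "x \<in> simplices (std_simplex n) k"
  then show "simp_op (std_simplex n) k k (\<lambda>i\<in>{..k}. i) x = x"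
    by (auto simp: std_simplex_def ord_maps_def PiE_def intro!: compose_Id)
next
  fix k m l \<eta> \<theta> x
  assume "\<eta> \<in> ord_maps k m"
  then show "simp_op (std_simplex n) k l (compose {..k} \<theta> \<eta>) x =
      simp_op (std_simplex n) k m \<eta> (simp_op (std_simplex n) m l \<theta> x)"
    by (auto simp: std_simplex_def ord_maps_def compose_def fun_eq_iff)
qed

lemma is_sset_diag_L:
  assumes "is_sset K"
  shows "is_sset_diag (L_diag s K)"
  using assms unfolding is_sset_diag_def L_diag_def is_sset_def sset_maps_def
  by (auto simp: Pi_iff intro: order_trans)

lemma is_sset_diag_vietoris_rips: "is_sset_diag (vietoris_rips X r)"
proof -
  have op: "compose {..m} \<sigma> \<theta> \<in> simplices (at_stage (vietoris_rips X r) s) m"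
    if "\<theta> \<in> ord_maps m n" "\<sigma> \<in> simplices (at_stage (vietoris_rips X r) s) n" for m n \<theta> \<sigma> s
    using that
    by (auto simp: vietoris_rips_def Let_def nerve_def ord_maps_def compose_def mono_on_def
        PiE_iff)
  have stage: "is_sset (at_stage (vietoris_rips X r) s)" for s
    unfolding is_sset_def
  proof (intro conjI allI ballI)
    let ?K = "at_stage (vietoris_rips X r) s"
    have sop: "simp_op ?K m n \<theta> \<sigma> = compose {..m} \<sigma> \<theta>" for m n \<theta> \<sigma>
      by (simp add: vietoris_rips_def Let_def nerve_def)
    show "simp_op ?K m n \<theta> \<in> simplices ?K n \<rightarrow> simplices ?K m" if "\<theta> \<in> ord_maps m n" for m n \<theta>
      using op[OF that] by (auto simp: sop)
    show "simp_op ?K n n (\<lambda>i\<in>{..n}. i) x = x" if "x \<in> simplices ?K n" for n x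
      unfolding sop using that
      by (intro compose_Id[where B = "ep_pts X"])
        (auto simp: vietoris_rips_def Let_def nerve_def PiE_iff)
    show "simp_op ?K k n (compose {..k} \<theta> \<eta>) x = simp_op ?K k m \<eta> (simp_op ?K m n \<theta> x)"
      if "\<eta> \<in> ord_maps k m" for k m n \<eta> \<theta> x
      unfolding sop using that by (auto simp: ord_maps_def compose_def fun_eq_iff)
  qed
  have mono: "simplices (at_stage (vietoris_rips X r) s) n \<subseteq> simplices (at_stage (vietoris_rips X r) t) n"
    if "s \<le> t" for s t n
    using that by (auto simp: vietoris_rips_def Let_def intro: order_trans)
  have sop: "simp_op (at_stage (vietoris_rips X r) s) m n \<theta> \<sigma> = compose {..m} \<sigma> \<theta>" for s m n \<theta> \<sigma>
    by (simp add: vietoris_rips_def Let_def nerve_def)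
  have tr: "transition (vietoris_rips X r) s t n =
      (\<lambda>\<sigma>\<in>simplices (at_stage (vietoris_rips X r) s) n. \<sigma>)" for s t n
    by (simp add: vietoris_rips_def Let_def)
  show ?thesis
    unfolding is_sset_diag_def sset_maps_def
    using stage mono op by (auto simp: tr sop) blast+
qed

lemma ep_metric_U: "ep_metric (U_space n s)"
  by (auto simp: ep_metric_def U_space_def)

lemma vertex_simplex: "i \<le> m \<Longrightarrow> (\<lambda>j\<in>{..0}. i) \<in> ord_maps 0 m"
  by (auto simp: ord_maps_def mono_on_def)

lemma simplex_homs_le:
  assumes "\<phi> \<in> simplex_homs (t, m, g) (s, n, f)"
  shows "s \<le> t"
proof (rule ccontr)
  assume "\<not> s \<le> t"
  moreover have "\<phi> t \<in> sset_maps (at_stage (L_diag t (std_simplex m)) t)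
      (at_stage (L_diag s (std_simplex n)) t)"
    using assms by (simp add: simplex_homs_def diag_maps_def)
  ultimately have "\<phi> t 0 \<in> ord_maps 0 m \<rightarrow>\<^sub>E {}"
    by (auto simp: sset_maps_def L_diag_def std_simplex_def dest: spec[of _ 0])
  with vertex_simplex[of 0 m] show False by blast
qed

lemma U_mor_in_maps:
  assumes "\<phi> \<in> simplex_homs a b"
  shows "U_mor a b \<phi> \<in> ep_maps (U_obj a) (U_obj b)"
proof -
  obtain t m g where a: "a = (t, m, g)" by (cases a)
  obtain s n f where b: "b = (s, n, f)" by (cases b)
  have st: "s \<le> t" using assms simplex_homs_le a b by blast
  have "\<phi> t \<in> sset_maps (at_stage (L_diag t (std_simplex m)) t)
      (at_stage (L_diag s (std_simplex n)) t)"
    using assms by (simp add: a b simplex_homs_def diag_maps_def)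
  then have "\<phi> t 0 \<in> ord_maps 0 m \<rightarrow>\<^sub>E ord_maps 0 n"
    using st by (auto simp: sset_maps_def L_diag_def std_simplex_def)
  then have "\<phi> t 0 (\<lambda>j\<in>{..0}. i) \<in> ord_maps 0 n" if "i \<le> m" for i
    using vertex_simplex[OF that] by blast
  then have "\<phi> t 0 (\<lambda>j\<in>{..0}. i) 0 \<le> n" if "i \<le> m" for i
    using that by (fastforce simp: ord_maps_def PiE_iff)
  then show ?thesis using st
    by (auto simp: a b U_mor_def U_obj_def U_space_def ep_maps_def)
qed

theorem realization_cocone:
  assumes "a \<in> simplex_objs Y" "b \<in> simplex_objs Y" "\<phi> \<in> simplex_homs a b"
    and "x \<in> ep_pts (U_obj a)"
  shows "coproj (simplex_objs Y) simplex_homs U_obj U_mor b (U_mor a b \<phi> x) =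
    coproj (simplex_objs Y) simplex_homs U_obj U_mor a x"
  using assms U_mor_in_maps by (intro coproj_cocone)

end

theory Submission
  imports Defs
begin

text \<open>
  By the Yoneda lemma an object of the category of simplices of the Vietoris-Rips diagram is a
  string \<open>x\<^sub>0 \<le> \<dots> \<le> x\<^sub>n\<close> of diameter at most \<open>s\<close>, and its vertex maps form
  a cocone with vertex \<open>X\<close>. The inverse of the induced map sends \<open>x\<close> to the point of the
  \<open>0\<close>-simplex \<open>x\<close> at stage \<open>\<infinity>\<close>: since morphisms go from later to earlier
  stages, this object maps to every simplex at each of its vertices \<open>x\<close>. The inverse does not increase
  distances because for \<open>x \<le> y\<close> the string \<open>(x, y)\<close> is a \<open>1\<close>-simplex at stage
  \<open>d(x, y)\<close>.
\<close>

lemma identity_ord_map: "(\<lambda>j\<in>{..n}. j) \<in> ord_maps n n"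
  by (auto simp: ord_maps_def mono_on_def)

lemma compose_identity_ord_map:
  assumes "\<theta> \<in> ord_maps k n"
  shows "compose {..k} (\<lambda>j\<in>{..n}. j) \<theta> = \<theta>"
  using assms by (auto simp: ord_maps_def compose_def fun_eq_iff PiE_iff extensional_def)

section \<open>The Yoneda lemma for diagrams of simplicial sets\<close>

text \<open>The Yoneda correspondence: evaluation at the universal \<open>n\<close>-simplex, the
  identity of \<open>{..n}\<close>. For Vietoris-Rips diagrams the result is itself a function on
  vertices, so it serves as the cocone leg from \<open>U_obj a\<close> to \<open>X\<close>.\<close>

definition classified_simplex :: "'a simplex_obj \<Rightarrow> 'a" where
  "classified_simplex = (\<lambda>(s, n, f). f s n (\<lambda>j\<in>{..n}. j))"

text \<open>The inverse direction of the correspondence. The empty domain before stage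
  \<open>s\<close> makes every component extensional on the simplices of \<open>L_diag\<close>, as
  \<open>sset_maps\<close> demands.\<close>

definition classifying_map ::
  "'a sset_diag \<Rightarrow> ennreal \<Rightarrow> nat \<Rightarrow> 'a \<Rightarrow> ennreal \<Rightarrow> nat \<Rightarrow> (nat \<Rightarrow> nat) \<Rightarrow> 'a" where
  "classifying_map Y s n \<sigma> = (\<lambda>t k. \<lambda>\<theta>\<in>(if s \<le> t then ord_maps k n else {}).
     simp_op (at_stage Y t) k n \<theta> (transition Y s t n \<sigma>))"

lemma classified_simplex_in_simplices:
  assumes "f \<in> diag_maps (L_diag s (std_simplex n)) Y"
  shows "classified_simplex (s, n, f) \<in> simplices (at_stage Y s) n"
proof -
  have "f s \<in> sset_maps (at_stage (L_diag s (std_simplex n)) s) (at_stage Y s)"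
    using assms by (auto simp: diag_maps_def)
  then have "f s n \<in> ord_maps n n \<rightarrow>\<^sub>E simplices (at_stage Y s) n"
    by (auto simp: sset_maps_def L_diag_def std_simplex_def)
  then show ?thesis
    using identity_ord_map by (auto simp: classified_simplex_def)
qed

text \<open>Naturality used twice: \<theta> is the pullback of the identity along itself, and the
  identity at stage \<open>t\<close> is the transition of the identity at stage
  \<open>s\<close>.\<close>

lemma diag_map_from_simplex:
  assumes f: "f \<in> diag_maps (L_diag s (std_simplex n)) Y"
    and "s \<le> t" and \<theta>: "\<theta> \<in> ord_maps k n"
  shows "f t k \<theta> =
    simp_op (at_stage Y t) k n \<theta> (transition Y s t n (classified_simplex (s, n, f)))"
proof -
  let ?i = "\<lambda>j\<in>{..n}. j"
  have "f t \<in> sset_maps (at_stage (L_diag s (std_simplex n)) t) (at_stage Y t)"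
    using f by (auto simp: diag_maps_def)
  then have "f t k (compose {..k} ?i \<theta>) = simp_op (at_stage Y t) k n \<theta> (f t n ?i)"
    using \<theta> \<open>s \<le> t\<close> identity_ord_map
    by (auto simp: sset_maps_def L_diag_def std_simplex_def)
  moreover have "?i \<in> simplices (at_stage (L_diag s (std_simplex n)) s) n"
    using identity_ord_map by (simp add: L_diag_def std_simplex_def)
  then have "f t n (transition (L_diag s (std_simplex n)) s t n ?i)
      = transition Y s t n (f s n ?i)"
    using f \<open>s \<le> t\<close> unfolding diag_maps_def by blast
  then have "f t n ?i = transition Y s t n (f s n ?i)"
    using identity_ord_map by (simp add: L_diag_def std_simplex_def)
  ultimately show ?thesis
    using compose_identity_ord_map[OF \<theta>] by (simp add: classified_simplex_def)
qed

text \<open>Compatibility with simplicial operators is functoriality of the structure maps of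
  \<open>Y\<close>; compatibility with transitions holds because those of \<open>Y\<close> are
  functorial and simplicial.\<close>

lemma classifying_map_in_diag_maps:
  assumes Y: "is_sset_diag Y" and \<sigma>: "\<sigma> \<in> simplices (at_stage Y s) n"
  shows "classifying_map Y s n \<sigma> \<in> diag_maps (L_diag s (std_simplex n)) Y"
proof -
  let ?L = "L_diag s (std_simplex n)"
  have stage: "is_sset (at_stage Y t)" for t
    using Y by (simp add: is_sset_diag_def)
  have tr: "transition Y t u \<in> sset_maps (at_stage Y t) (at_stage Y u)" if "t \<le> u" for t u
    using Y that by (simp add: is_sset_diag_def)
  have tr\<sigma>: "transition Y s t n \<sigma> \<in> simplices (at_stage Y t) n" if "s \<le> t" for t
    using tr[OF that] \<sigma> by (auto simp: sset_maps_def)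
  have "classifying_map Y s n \<sigma> t \<in> sset_maps (at_stage ?L t) (at_stage Y t)" for t
    unfolding sset_maps_def mem_Collect_eq
  proof (intro conjI allI ballI)
    fix k
    show "classifying_map Y s n \<sigma> t k
        \<in> simplices (at_stage ?L t) k \<rightarrow>\<^sub>E simplices (at_stage Y t) k"
      using stage[of t] tr\<sigma>[of t]
      by (auto simp: classifying_map_def L_diag_def std_simplex_def is_sset_def)
  next
    fix k l \<eta> \<theta>
    assume "\<eta> \<in> ord_maps k l" "\<theta> \<in> simplices (at_stage ?L t) l"
    then show "classifying_map Y s n \<sigma> t k (simp_op (at_stage ?L t) k l \<eta> \<theta>)
        = simp_op (at_stage Y t) k l \<eta> (classifying_map Y s n \<sigma> t l \<theta>)"
      using stage[of t] tr\<sigma>[of t] ord_maps_comp[of \<eta> k l \<theta> n]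
      by (auto simp: classifying_map_def L_diag_def std_simplex_def is_sset_def split: if_splits)
  qed
  moreover have "classifying_map Y s n \<sigma> u k (transition ?L t u k \<theta>)
      = transition Y t u k (classifying_map Y s n \<sigma> t k \<theta>)"
    if "t \<le> u" "\<theta> \<in> simplices (at_stage ?L t) k" for t u k \<theta>
  proof -
    \<comment> \<open>Before stage \<open>s\<close> the source has no simplices, so only later
      stages matter.\<close>
    have st: "s \<le> t" and \<theta>: "\<theta> \<in> ord_maps k n"
      using that by (auto simp: L_diag_def std_simplex_def split: if_splits)
    have "transition Y s u n \<sigma> = transition Y t u n (transition Y s t n \<sigma>)"
      using Y st \<open>t \<le> u\<close> \<sigma> unfolding is_sset_diag_def by blast
    moreover have "transition Y t u k (simp_op (at_stage Y t) k n \<theta> (transition Y s t n \<sigma>))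
        = simp_op (at_stage Y u) k n \<theta> (transition Y t u n (transition Y s t n \<sigma>))"
      using tr[OF \<open>t \<le> u\<close>] \<theta> tr\<sigma>[OF st] by (simp add: sset_maps_def)
    ultimately show ?thesis
      using st \<theta> \<open>t \<le> u\<close> order_trans[OF st \<open>t \<le> u\<close>]
      by (simp add: classifying_map_def L_diag_def std_simplex_def)
  qed
  ultimately show ?thesis
    by (simp add: diag_maps_def)
qed

lemma classified_simplex_classifying_map:
  assumes Y: "is_sset_diag Y" and \<sigma>: "\<sigma> \<in> simplices (at_stage Y s) n"
  shows "classified_simplex (s, n, classifying_map Y s n \<sigma>) = \<sigma>"
proof -
  have "transition Y s s n \<sigma> = \<sigma>"
    using Y \<sigma> by (simp add: is_sset_diag_def)
  moreover have "simp_op (at_stage Y s) n n (\<lambda>j\<in>{..n}. j) \<sigma> = \<sigma>"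
    using Y \<sigma> by (simp add: is_sset_diag_def is_sset_def)
  ultimately show ?thesis
    using identity_ord_map by (simp add: classified_simplex_def classifying_map_def)
qed

text \<open>A morphism of the category of simplices is itself a diagram map, so Yoneda with target
  an \<open>L_diag\<close> reduces it to one monotone map; pulling back along a vertex evaluates
  this map there.\<close>

lemma U_mor_eq_classified_simplex:
  assumes "\<phi> \<in> simplex_homs (t, m, g) (s, n, f)" and "i \<le> m"
  shows "U_mor (t, m, g) (s, n, f) \<phi> i = classified_simplex (t, m, \<phi>) i"
proof -
  have \<phi>: "\<phi> \<in> diag_maps (L_diag t (std_simplex m)) (L_diag s (std_simplex n))"
    using assms by (simp add: simplex_homs_def)
  have "s \<le> t"
    using simplex_homs_le[OF assms(1)] .
  moreover have "classified_simplex (t, m, \<phi>) \<in> ord_maps m n"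
    using classified_simplex_in_simplices[OF \<phi>] \<open>s \<le> t\<close>
    by (simp add: L_diag_def std_simplex_def)
  ultimately show ?thesis
    using diag_map_from_simplex[OF \<phi> order_refl vertex_simplex[OF \<open>i \<le> m\<close>]] \<open>i \<le> m\<close>
    by (simp add: U_mor_def L_diag_def std_simplex_def compose_def)
qed

section \<open>Simplices of the Vietoris-Rips diagram\<close>

lemma vietoris_rips_simplices:
  "\<sigma> \<in> simplices (at_stage (vietoris_rips X r) s) n \<longleftrightarrow>
     \<sigma> \<in> {..n} \<rightarrow>\<^sub>E ep_pts X \<and> (\<forall>i j. i \<le> j \<and> j \<le> n \<longrightarrow> (\<sigma> i, \<sigma> j) \<in> r) \<and>
     (\<forall>i\<le>n. \<forall>j\<le>n. ep_dist X (\<sigma> i) (\<sigma> j) \<le> s)"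
  by (auto simp: vietoris_rips_def nerve_def Let_def)

lemma vietoris_rips_simp_op:
  "simp_op (at_stage (vietoris_rips X r) s) m n \<theta> \<sigma> = compose {..m} \<sigma> \<theta>"
  by (simp add: vietoris_rips_def Let_def nerve_def)

lemma vietoris_rips_transition:
  assumes "\<sigma> \<in> simplices (at_stage (vietoris_rips X r) s) n"
  shows "transition (vietoris_rips X r) s t n \<sigma> = \<sigma>"
  using assms by (simp add: vietoris_rips_def Let_def)

text \<open>Transitions are inclusions and structure maps are precompositions, so the Yoneda formula
  loses its dependence on the stage.\<close>

lemma diag_map_to_vietoris_rips:
  assumes "f \<in> diag_maps (L_diag s (std_simplex n)) (vietoris_rips X r)"
    and "s \<le> t" and "\<theta> \<in> ord_maps k n"
  shows "f t k \<theta> = compose {..k} (classified_simplex (s, n, f)) \<theta>"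
  using diag_map_from_simplex[OF assms] classified_simplex_in_simplices[OF assms(1)]
  by (simp add: vietoris_rips_simp_op vietoris_rips_transition)

text \<open>Distinct points of \<open>U_space n s\<close> are at distance \<open>s\<close>, which
  bounds the diameter of the string.\<close>

lemma classified_simplex_in_ep_maps:
  assumes X: "ep_metric X" and a: "a \<in> simplex_objs (vietoris_rips X r)"
  shows "classified_simplex a \<in> ep_maps (U_obj a) X"
proof -
  obtain s n f where a_eq: "a = (s, n, f)" by (cases a)
  have "classified_simplex a \<in> simplices (at_stage (vietoris_rips X r) s) n"
    using a classified_simplex_in_simplices by (simp add: a_eq simplex_objs_def)
  then show ?thesis
    using X by (auto simp: a_eq vietoris_rips_simplices ep_maps_def U_obj_def U_space_def
        ep_metric_def PiE_iff)
qed

text \<open>The cocone condition: it is the commuting triangle over the Vietoris-Rips diagram,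
  evaluated at the universal simplex of the source.\<close>

lemma classified_simplex_U_mor:
  assumes b: "b \<in> simplex_objs (vietoris_rips X r)"
    and \<phi>: "\<phi> \<in> simplex_homs a b" and i: "i \<in> ep_pts (U_obj a)"
  shows "classified_simplex b (U_mor a b \<phi> i) = classified_simplex a i"
proof -
  obtain t m g where a_eq: "a = (t, m, g)" by (cases a)
  obtain s n f where b_eq: "b = (s, n, f)" by (cases b)
  have st: "s \<le> t" and im: "i \<le> m"
    using simplex_homs_le \<phi> i by (auto simp: a_eq b_eq U_obj_def U_space_def)
  have \<phi>': "\<phi> \<in> diag_maps (L_diag t (std_simplex m)) (L_diag s (std_simplex n))"
    and g: "g = diag_comp (L_diag t (std_simplex m)) f \<phi>"
    using \<phi> by (auto simp: simplex_homs_def a_eq b_eq)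
  have f: "f \<in> diag_maps (L_diag s (std_simplex n)) (vietoris_rips X r)"
    using b by (simp add: b_eq simplex_objs_def)
  have \<tau>: "classified_simplex (t, m, \<phi>) \<in> ord_maps m n"
    using classified_simplex_in_simplices[OF \<phi>'] st by (simp add: L_diag_def std_simplex_def)
  have "classified_simplex a = f t m (classified_simplex (t, m, \<phi>))"
    using identity_ord_map
    by (simp add: a_eq g classified_simplex_def diag_comp_def L_diag_def std_simplex_def
        compose_def)
  then show ?thesis
    using diag_map_to_vietoris_rips[OF f st \<tau>] U_mor_eq_classified_simplex[of \<phi> t m g s n f i] \<phi> im
    by (simp add: a_eq b_eq compose_def)
qed

definition rips_point :: "'a ep_space \<Rightarrow> 'a rel \<Rightarrow> 'a \<Rightarrow> (nat \<Rightarrow> 'a) simplex_obj" where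
  "rips_point X r x = (\<infinity>, 0, classifying_map (vietoris_rips X r) \<infinity> 0 (\<lambda>j\<in>{..0}. x))"

lemma rips_point_properties:
  assumes "refl_on (ep_pts X) r" and "x \<in> ep_pts X"
  shows rips_point_in_simplex_objs: "rips_point X r x \<in> simplex_objs (vietoris_rips X r)"
    and classified_simplex_rips_point: "classified_simplex (rips_point X r x) = (\<lambda>j\<in>{..0}. x)"
proof -
  have \<sigma>: "(\<lambda>j\<in>{..0}. x) \<in> simplices (at_stage (vietoris_rips X r) \<infinity>) 0"
    using assms by (auto simp: vietoris_rips_simplices refl_on_def)
  show "rips_point X r x \<in> simplex_objs (vietoris_rips X r)"
    using classifying_map_in_diag_maps[OF is_sset_diag_vietoris_rips \<sigma>]
    by (simp add: rips_point_def simplex_objs_def)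
  show "classified_simplex (rips_point X r x) = (\<lambda>j\<in>{..0}. x)"
    unfolding rips_point_def
    by (rule classified_simplex_classifying_map[OF is_sset_diag_vietoris_rips \<sigma>])
qed

text \<open>This controls the gluing in the realization: each vertex of a simplex is identified with
  the single point of the \<open>rips_point\<close> at its label, so vertices with equal labels
  coincide.\<close>

lemma vertex_hom:
  assumes r: "refl_on (ep_pts X) r"
    and a: "a \<in> simplex_objs (vietoris_rips X r)" and i: "i \<in> ep_pts (U_obj a)"
  shows "\<exists>\<phi>\<in>simplex_homs (rips_point X r (classified_simplex a i)) a.
    U_mor (rips_point X r (classified_simplex a i)) a \<phi> 0 = i"
proof -
  obtain s n f where a_eq: "a = (s, n, f)" by (cases a)
  let ?x = "classified_simplex a i" and ?v = "\<lambda>j\<in>{..0::nat}. i"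
  let ?L = "L_diag s (std_simplex n)" and ?P = "L_diag \<infinity> (std_simplex 0)"
  \<comment> \<open>The vertex \<open>i\<close> is still present in \<open>?L\<close> at stage
    \<infinity>, and by Yoneda it yields the desired morphism.\<close>
  let ?\<phi> = "classifying_map ?L \<infinity> 0 ?v"
  have i_le: "i \<le> n"
    using i by (simp add: a_eq U_obj_def U_space_def)
  have f: "f \<in> diag_maps ?L (vietoris_rips X r)"
    using a by (simp add: a_eq simplex_objs_def)
  have x: "?x \<in> ep_pts X"
    using classified_simplex_in_simplices[OF f] i_le
    by (auto simp: a_eq vietoris_rips_simplices)
  have L: "is_sset_diag ?L"
    by (intro is_sset_diag_L is_sset_std_simplex)
  have v: "?v \<in> simplices (at_stage ?L \<infinity>) 0"
    using vertex_simplex[OF i_le] by (simp add: L_diag_def std_simplex_def)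
  note \<phi> = classifying_map_in_diag_maps[OF L v]
  obtain g where p: "rips_point X r ?x = (\<infinity>, 0, g)"
    and g: "g \<in> diag_maps ?P (vietoris_rips X r)"
    and cg: "classified_simplex (\<infinity>, 0, g) = (\<lambda>j\<in>{..0}. ?x)"
    using rips_point_properties[OF r x]
    unfolding rips_point_def simplex_objs_def mem_Collect_eq case_prod_conv by blast
  have "diag_comp ?P f ?\<phi> t k \<theta> = g t k \<theta>" for t k \<theta>
  \<comment> \<open>The source \<open>?P\<close> has simplices only at \<infinity>, the top stage;
    elsewhere both sides are \<open>undefined\<close> by extensionality.\<close>
  proof (cases "t = \<infinity> \<and> \<theta> \<in> ord_maps k 0")
    case True
    then have t: "t = \<infinity>" and \<theta>: "\<theta> \<in> ord_maps k 0" by auto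
    have \<phi>\<theta>: "?\<phi> \<infinity> k \<theta> = compose {..k} ?v \<theta>"
      using \<theta> vertex_simplex[OF i_le]
      by (simp add: classifying_map_def L_diag_def std_simplex_def)
    have "diag_comp ?P f ?\<phi> \<infinity> k \<theta> = f \<infinity> k (?\<phi> \<infinity> k \<theta>)"
      using \<theta> unfolding diag_comp_def compose_def by (simp add: L_diag_def std_simplex_def)
    moreover have "f \<infinity> k (compose {..k} ?v \<theta>)
        = compose {..k} (classified_simplex (s, n, f)) (compose {..k} ?v \<theta>)"
      using ord_maps_comp[OF \<theta> vertex_simplex[OF i_le]]
      by (intro diag_map_to_vietoris_rips[OF f]) auto
    moreover have "g \<infinity> k \<theta> = compose {..k} (\<lambda>j\<in>{..0}. ?x) \<theta>"
      using diag_map_to_vietoris_rips[OF g order_refl \<theta>] cg by simp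
    \<comment> \<open>Since \<open>{..0}\<close> has one element, both composites are constant with
      value \<open>?x\<close>.\<close>
    moreover have "\<theta> j = 0" if "j \<le> k" for j
      using \<theta> that by (auto simp: ord_maps_def PiE_iff)
    ultimately show ?thesis
      unfolding t \<phi>\<theta> a_eq by (auto simp: compose_def)
  next
    case False
    have "g t \<in> sset_maps (at_stage ?P t) (at_stage (vietoris_rips X r) t)"
      using g by (simp add: diag_maps_def)
    then have "g t k \<in> extensional (simplices (at_stage ?P t) k)"
      by (auto simp: sset_maps_def PiE_iff)
    moreover have "\<theta> \<notin> simplices (at_stage ?P t) k"
      using False by (auto simp: L_diag_def std_simplex_def top_unique split: if_splits)
    ultimately show ?thesis
      by (simp add: diag_comp_def compose_def extensional_def)
  qed
  then have hom: "?\<phi> \<in> simplex_homs (\<infinity>, 0, g) (s, n, f)"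
    using \<phi> by (auto simp: simplex_homs_def fun_eq_iff)
  moreover have "U_mor (\<infinity>, 0, g) (s, n, f) ?\<phi> 0 = i"
    using U_mor_eq_classified_simplex[OF hom, of 0] classified_simplex_classifying_map[OF L v]
    by simp
  ultimately show ?thesis
    unfolding p a_eq[symmetric] by blast
qed

section \<open>The realization of the Vietoris-Rips diagram\<close>

theorem mainTheorem3:
  fixes X :: "'a ep_space" and r :: "'a rel"
  assumes "ep_metric X"
    and "linear_order_on (ep_pts X) r"
  shows "ep_isomorphic (realization (vietoris_rips X r)) X"
proof -
  let ?V = "vietoris_rips X r" and ?p = "rips_point X r"
  let ?R = "realization ?V"
  let ?c = "coproj (simplex_objs ?V) simplex_homs U_obj U_mor"
  have r: "refl_on (ep_pts X) r" and tot: "total_on (ep_pts X) r"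
    using assms(2) by (auto simp: order_on_defs)
  obtain u where u: "u \<in> ep_maps ?R X"
    and uc: "\<And>a i. a \<in> simplex_objs ?V \<Longrightarrow> i \<in> ep_pts (U_obj a) \<Longrightarrow>
      u (?c a i) = classified_simplex a i"
    using ep_colimit_universal[where I = "simplex_objs ?V" and H = simplex_homs
        and F = U_obj and Fm = U_mor and h = classified_simplex, OF assms(1)]
      classified_simplex_in_ep_maps[OF assms(1)] classified_simplex_U_mor
    unfolding realization_def by blast
  have c: "?c a \<in> ep_maps (U_obj a) ?R" if "a \<in> simplex_objs ?V" for a
    using coproj_in_maps[OF that] by (simp add: realization_def)
  have 0: "0 \<in> ep_pts (U_obj (?p x))" for x
    by (simp add: rips_point_def U_obj_def U_space_def)
  define g where "g = (\<lambda>x\<in>ep_pts X. ?c (?p x) 0)"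
  \<comment> \<open>This identity serves both the distance bound for \<open>g\<close> and the
    equation \<open>g (u q) = q\<close>.\<close>
  have g_classified: "g (classified_simplex a i) = ?c a i"
    if a: "a \<in> simplex_objs ?V" and i: "i \<in> ep_pts (U_obj a)" for a i
  proof -
    have x: "classified_simplex a i \<in> ep_pts X"
      using classified_simplex_in_ep_maps[OF assms(1) a] i
      by (auto simp: ep_maps_def)
    obtain \<phi> where \<phi>: "\<phi> \<in> simplex_homs (?p (classified_simplex a i)) a"
      and "U_mor (?p (classified_simplex a i)) a \<phi> 0 = i"
      using vertex_hom[OF r a i] by blast
    then show ?thesis
      using realization_cocone[OF rips_point_in_simplex_objs[OF r x] a \<phi> 0] x
      by (simp add: g_def)
  qed
  have gR: "g x \<in> ep_pts ?R" if "x \<in> ep_pts X" for x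
    using c[OF rips_point_in_simplex_objs[OF r that]] 0 that by (auto simp: g_def ep_maps_def)
  have R: "ep_metric ?R"
    by (simp add: realization_def ep_metric_colimit)
  have g_le: "ep_dist ?R (g x) (g y) \<le> ep_dist X x y"
    if x: "x \<in> ep_pts X" and y: "y \<in> ep_pts X" and xy: "(x, y) \<in> r" for x y
  proof -
    \<comment> \<open>At exactly this stage the two points of the edge are as far apart as
      \<open>x\<close> and \<open>y\<close>, and the coprojection passes the bound on to the
      realization.\<close>
    let ?s = "ep_dist X x y" and ?\<sigma> = "\<lambda>j\<in>{..1::nat}. if j = 0 then x else y"
    let ?a = "(?s, 1, classifying_map ?V ?s 1 ?\<sigma>) :: (nat \<Rightarrow> 'a) simplex_obj"
    \<comment> \<open>The diameter condition also ranges over diagonal and reversed pairs of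
      indices.\<close>
    have "ep_dist X x x = 0" "ep_dist X y y = 0" "ep_dist X y x = ?s"
      using assms(1) x y by (auto simp: ep_metric_def)
    then have \<sigma>: "?\<sigma> \<in> simplices (at_stage ?V ?s) 1"
      using x y xy r by (auto simp: vietoris_rips_simplices refl_on_def)
    have a: "?a \<in> simplex_objs ?V"
      using classifying_map_in_diag_maps[OF is_sset_diag_vietoris_rips \<sigma>]
      by (simp add: simplex_objs_def)
    have \<sigma>_eq: "classified_simplex ?a = ?\<sigma>"
      by (rule classified_simplex_classifying_map[OF is_sset_diag_vietoris_rips \<sigma>])
    have "ep_dist ?R (?c ?a 0) (?c ?a 1) \<le> ?s"
    proof -
      have "0 \<in> ep_pts (U_obj ?a)" "1 \<in> ep_pts (U_obj ?a)" "ep_dist (U_obj ?a) 0 1 = ?s"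
        by (auto simp: U_obj_def U_space_def)
      then show ?thesis
        using c[OF a] unfolding ep_maps_def by fastforce
    qed
    moreover have "?c ?a 0 = g x" "?c ?a 1 = g y"
      using g_classified[OF a, of 0] g_classified[OF a, of 1]
      unfolding \<sigma>_eq by (simp_all add: U_obj_def U_space_def)
    ultimately show ?thesis by simp
  qed
  have "ep_dist ?R (g x) (g y) \<le> ep_dist X x y" if x: "x \<in> ep_pts X" and y: "y \<in> ep_pts X" for x y
  proof -
    \<comment> \<open>Only a pair in increasing order spans a string; symmetry of both distances
      settles the reversed order.\<close>
    have "(x, y) \<in> r \<or> (y, x) \<in> r"
      using r tot x y unfolding refl_on_def total_on_def by metis
    moreover have "ep_dist X x y = ep_dist X y x" "ep_dist ?R (g x) (g y) = ep_dist ?R (g y) (g x)"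
      using assms(1) R x y gR by (auto simp: ep_metric_def)
    ultimately show ?thesis
      using g_le x y by metis
  qed
  then have g: "g \<in> ep_maps X ?R"
    using gR by (auto simp: ep_maps_def g_def)
  have ug: "u (g x) = x" if "x \<in> ep_pts X" for x
    using uc[OF rips_point_in_simplex_objs[OF r that] 0] that
    by (simp add: g_def classified_simplex_rips_point[OF r that])
  have gu: "g (u q) = q" if "q \<in> ep_pts ?R" for q
  proof -
    \<comment> \<open>Every point of the colimit comes from a vertex: \<open>u\<close> reads off its
      label and \<open>g\<close> restores the point.\<close>
    have "q \<in> colim_pts (simplex_objs ?V) simplex_homs U_obj U_mor"
      using that by (simp add: realization_def ep_colimit_def)
    then show ?thesis
      by (elim colim_pts_cases) (simp add: uc g_classified)
  qed
  show ?thesis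
    unfolding ep_isomorphic_def using u g ug gu by blast
qed

end
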